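(* Let $G$ be a group acting with continuous semi-algebraic maps on a semi-algebraic set $V\subset\mathbb{R}^n$. Suppose that $\mathcal{G}$ is a (possibly infinite) proper family of continuous semi-algebraic functions $V\to\mathbb{R}_{>0}$ that is invariant for the action of $G$. Then the action of $G$ on $V$ extends continuously to an action on the compactification $\overline V_{\mathcal{G}}$.
   Context: Invariance of $\mathcal{G}$ means that $f\circ g\in\mathcal{G}$ for all $f\in\mathcal{G}$, $g\in G$. For $0<t<1$ let $\mathrm{Log}_{1/t}:(\mathbb{R}_{>0})^m\to\mathbb{R}^m$ be the componentwise logarithm in base $1/t$. For $W\subset(\mathbb{R}_{>0})^m$ let $\mathcal{A}_t(W)=\mathrm{Log}_{1/t}(W)$ and let $\mathcal{A}_0(W)$ (logarithmic limit set) be the set of $x\in\mathbb{R}^m$ for which there are $t_k\to0^+$ and $w_k\in W$ with $\mathrm{Log}_{1/t_k}(w_k)\to x$; it is a closed cone. For $W$ closed semi-algebraic put $\partial W=(\mathcal{A}_0(W)\setminus\{0\})/\!\sim$, where $x\sim y$ iff $x=\lambda y$ for some $\lambda>0$, viewed as a subset of $S^{m-1}$. Compactify $\mathbb{R}^m$ to the closed ball $D^m=\mathbb{R}^m\cup S^{m-1}$ via $x\mapsto x/\sqrt{1+\|x\|^2}$. Fix $t_0\in(0,1)$; $\overline W=\mathcal{A}_{t_0}(W)\cup\partial W$ is the closure of $\mathcal{A}_{t_0}(W)$ in $D^m$. A finite family $\mathcal{F}=\{f_1,\dots,f_m\}$ of continuous semi-algebraic functions $V\to\mathbb{R}_{>0}$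 is proper if $E_{\mathcal{F}}=(f_1,\dots,f_m):V\to(\mathbb{R}_{>0})^m$ is a proper map. An arbitrary family $\mathcal{G}$ is proper if it contains a finite proper subfamily; $P_{\mathcal{G}}$ is the set of finite proper subfamilies of $\mathcal{G}$, ordered by inclusion. Coordinate projections make $\{\overline{E_{\mathcal{F}}(V)}\}_{\mathcal{F}\in P_{\mathcal{G}}}$ an inverse system; let $M$ be its limit, $L_{\mathcal{G}}:V\to M$ the map induced by the maps $\mathrm{Log}_{1/t_0}\circ E_{\mathcal{F}}$, and $\hat V=V\cup\{\infty\}$ the Alexandrov compactification. $\overline V_{\mathcal{G}}$ is the closure in $\hat V\times M$ of the image of $i:V\to\hat V\times M$, $i(x)=(x,L_{\mathcal{G}}(x))$; $i:V\to\overline V_{\mathcal{G}}$ is a compactification of $V$ (an embedding as an open dense subset of a compact space). *)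

theory Defs
  imports "HOL-Analysis.Analysis" "HOL-Algebra.Group_Action"
begin

section \<open>Semi-algebraic sets and maps\<close>

text \<open>The smallest Boolean algebra of subsets containing all \<open>{x. p x > 0}\<close> with \<open>p\<close> a real
  polynomial (closure under intersection follows from unions and complements). On a Euclidean space,
  \<^const>\<open>real_polynomial_function\<close> holds of exactly the polynomials in the coordinates.\<close>

inductive semialgebraic :: "'a::euclidean_space set \<Rightarrow> bool" where
  pos: "real_polynomial_function p \<Longrightarrow> semialgebraic {x. p x > 0}"
| union: "semialgebraic A \<Longrightarrow> semialgebraic B \<Longrightarrow> semialgebraic (A \<union> B)"
| compl: "semialgebraic A \<Longrightarrow> semialgebraic (- A)"

definition semialgebraic_map_on ::
    "'a::euclidean_space set \<Rightarrow> ('a \<Rightarrow> 'b::euclidean_space) \<Rightarrow> bool" where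
  "semialgebraic_map_on V f \<longleftrightarrow> semialgebraic ((\<lambda>x. (x, f x)) ` V)"

text \<open>Functions on \<open>V\<close> are represented extensionally (\<^term>\<open>undefined\<close> outside \<open>V\<close>), so that a set
  of them is a family of functions on \<open>V\<close> and not of functions on the ambient space.\<close>

definition pos_semialgebraic_functions ::
    "'a::euclidean_space set \<Rightarrow> ('a \<Rightarrow> real) set" where
  "pos_semialgebraic_functions V =
     {f \<in> V \<rightarrow>\<^sub>E {0<..}. continuous_on V f \<and> semialgebraic_map_on V f}"

section \<open>Logarithmic limit sets and the ball compactification\<close>

text \<open>A point of \<open>\<real>\<^sup>m\<close> is a function in \<open>F \<rightarrow>\<^sub>E UNIV\<close> for a finite index set \<open>F\<close> with \<open>m\<close> elements;
  its Euclidean norm is \<^term>\<open>L2_set x F\<close>, and \<open>\<real>\<^sup>m\<close> carries the topology \<^term>\<open>powertop_real F\<close>.\<close>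

definition Log_vec :: "'i set \<Rightarrow> real \<Rightarrow> ('i \<Rightarrow> real) \<Rightarrow> 'i \<Rightarrow> real" where
  "Log_vec F t w = (\<lambda>i\<in>F. log (1 / t) (w i))"

definition amoeba :: "'i set \<Rightarrow> real \<Rightarrow> ('i \<Rightarrow> real) set \<Rightarrow> ('i \<Rightarrow> real) set" where
  "amoeba F t W = Log_vec F t ` W"

definition log_limit_set :: "'i set \<Rightarrow> ('i \<Rightarrow> real) set \<Rightarrow> ('i \<Rightarrow> real) set" where
  "log_limit_set F W = {x. \<exists>t w. (\<forall>k. 0 < t k \<and> t k < 1 \<and> w k \<in> W) \<and> t \<longlonglongrightarrow> 0 \<and>
     limitin (powertop_real F) (\<lambda>k. Log_vec F (t k) (w k)) x sequentially}"

text \<open>The quotient of \<open>\<A>\<^sub>0(W) - {0}\<close> by positive scaling, each ray being represented by its unit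
  vector.\<close>

definition log_boundary :: "'i set \<Rightarrow> ('i \<Rightarrow> real) set \<Rightarrow> ('i \<Rightarrow> real) set" where
  "log_boundary F W =
     (\<lambda>x. \<lambda>i\<in>F. x i / L2_set x F) ` {x \<in> log_limit_set F W. L2_set x F \<noteq> 0}"

definition ball_embed :: "'i set \<Rightarrow> ('i \<Rightarrow> real) \<Rightarrow> 'i \<Rightarrow> real" where
  "ball_embed F x = (\<lambda>i\<in>F. x i / sqrt (1 + (L2_set x F)\<^sup>2))"

text \<open>\<open>D\<^sup>m\<close> is the closed unit ball: its open part is \<open>\<real>\<^sup>m\<close> via \<^const>\<open>ball_embed\<close>, and its
  boundary sphere is the sphere at infinity.\<close>

definition log_compactification ::
    "'i set \<Rightarrow> real \<Rightarrow> ('i \<Rightarrow> real) set \<Rightarrow> ('i \<Rightarrow> real) set" where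
  "log_compactification F t\<^sub>0 W = ball_embed F ` amoeba F t\<^sub>0 W \<union> log_boundary F W"

text \<open>The coordinate projection \<open>\<real>\<^sup>F \<rightarrow> \<real>\<^bsup>F'\<^esup>\<close> for \<open>F' \<subseteq> F\<close>, read in the ball model. On the open
  ball it is conjugated by \<^const>\<open>ball_embed\<close> (see \<open>ball_proj_ball_embed\<close> below); on the sphere it
  is the induced map on rays, which makes sense when the projected vector is nonzero (and has no
  meaning otherwise).\<close>

definition ball_proj :: "'i set \<Rightarrow> 'i set \<Rightarrow> ('i \<Rightarrow> real) \<Rightarrow> 'i \<Rightarrow> real" where
  "ball_proj F F' x =
     (if L2_set x F < 1
      then ball_embed F' (\<lambda>i\<in>F'. x i / sqrt (1 - (L2_set x F)\<^sup>2))
      else (\<lambda>i\<in>F'. x i / L2_set x F'))"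

lemma ball_proj_ball_embed:
  assumes "finite F" "F' \<subseteq> F"
  shows "ball_proj F F' (ball_embed F y) = ball_embed F' (restrict y F')"
proof -
  define n where "n = L2_set y F"
  define s where "s = sqrt (1 + n\<^sup>2)"
  have s2: "s\<^sup>2 = 1 + n\<^sup>2" and s: "s > 0" by (auto simp: s_def add_pos_nonneg)
  have n: "n \<ge> 0" by (simp add: n_def)
  have "L2_set (ball_embed F y) F = L2_set (\<lambda>i. (1 / s) * y i) F"
    unfolding ball_embed_def s_def n_def by (rule L2_set_cong) auto
  also have "\<dots> = n / s"
    using s L2_set_right_distrib [of "1 / s" y F] by (simp add: n_def)
  finally have L: "L2_set (ball_embed F y) F = n / s" .
  have "n\<^sup>2 < s\<^sup>2" using s2 by simp
  then have "n < s" by (rule power2_less_imp_less [OF _ less_imp_le [OF s]])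
  then have lt: "n / s < 1" using s by simp
  have "n\<^sup>2 = s\<^sup>2 - 1" using s2 by simp
  then have "1 - (n / s)\<^sup>2 = (1 / s)\<^sup>2"
    using s by (simp add: power_divide diff_divide_distrib)
  then have r: "sqrt (1 - (n / s)\<^sup>2) = 1 / s"
    using s by simp
  have "(\<lambda>i\<in>F'. ball_embed F y i / (1 / s)) = restrict y F'"
    using assms s by (auto simp: ball_embed_def s_def n_def fun_eq_iff)
  then show ?thesis
    by (simp only: ball_proj_def L lt r if_True)
qed

section \<open>Proper families and the compactification\<close>

text \<open>A finite family is indexed by its own elements.\<close>

definition family_map ::
    "('a \<Rightarrow> real) set \<Rightarrow> 'a \<Rightarrow> ('a \<Rightarrow> real) \<Rightarrow> real" where
  "family_map F x = (\<lambda>f\<in>F. f x)"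

definition finite_proper_family ::
    "'a::euclidean_space set \<Rightarrow> ('a \<Rightarrow> real) set \<Rightarrow> bool" where
  "finite_proper_family V F \<longleftrightarrow> finite F \<and> F \<subseteq> pos_semialgebraic_functions V \<and>
     proper_map (top_of_set V) (product_topology (\<lambda>f. top_of_set {0<..}) F) (family_map F)"

definition proper_subfamilies ::
    "'a::euclidean_space set \<Rightarrow> ('a \<Rightarrow> real) set \<Rightarrow> ('a \<Rightarrow> real) set set" where
  "proper_subfamilies V \<G> = {F. F \<subseteq> \<G> \<and> finite_proper_family V F}"

definition proper_family ::
    "'a::euclidean_space set \<Rightarrow> ('a \<Rightarrow> real) set \<Rightarrow> bool" where
  "proper_family V \<G> \<longleftrightarrow>
     \<G> \<subseteq> pos_semialgebraic_functions V \<and> (\<exists>F. F \<subseteq> \<G> \<and> finite_proper_family V F)"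

definition family_compactification ::
    "'a::euclidean_space set \<Rightarrow> real \<Rightarrow> ('a \<Rightarrow> real) set \<Rightarrow> (('a \<Rightarrow> real) \<Rightarrow> real) set" where
  "family_compactification V t\<^sub>0 F = log_compactification F t\<^sub>0 (family_map F ` V)"

definition limit_space ::
    "'a::euclidean_space set \<Rightarrow> real \<Rightarrow> ('a \<Rightarrow> real) set
       \<Rightarrow> (('a \<Rightarrow> real) set \<Rightarrow> ('a \<Rightarrow> real) \<Rightarrow> real) topology" where
  "limit_space V t\<^sub>0 \<G> =
     subtopology
       (product_topology
         (\<lambda>F. subtopology (powertop_real F) (family_compactification V t\<^sub>0 F))
         (proper_subfamilies V \<G>))
       {m. \<forall>F\<in>proper_subfamilies V \<G>. \<forall>F'\<in>proper_subfamilies V \<G>.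
             F' \<subseteq> F \<longrightarrow> m F' = ball_proj F F' (m F)}"

definition limit_map ::
    "'a::euclidean_space set \<Rightarrow> real \<Rightarrow> ('a \<Rightarrow> real) set
       \<Rightarrow> 'a \<Rightarrow> ('a \<Rightarrow> real) set \<Rightarrow> ('a \<Rightarrow> real) \<Rightarrow> real" where
  "limit_map V t\<^sub>0 \<G> x =
     (\<lambda>F\<in>proper_subfamilies V \<G>. ball_embed F (Log_vec F t\<^sub>0 (family_map F x)))"

definition compactification_map ::
    "'a::euclidean_space set \<Rightarrow> real \<Rightarrow> ('a \<Rightarrow> real) set
       \<Rightarrow> 'a \<Rightarrow> 'a option \<times> (('a \<Rightarrow> real) set \<Rightarrow> ('a \<Rightarrow> real) \<Rightarrow> real)" where
  "compactification_map V t\<^sub>0 \<G> x = (Some x, limit_map V t\<^sub>0 \<G> x)"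

definition compactification_space ::
    "'a::euclidean_space set \<Rightarrow> real \<Rightarrow> ('a \<Rightarrow> real) set
       \<Rightarrow> ('a option \<times> (('a \<Rightarrow> real) set \<Rightarrow> ('a \<Rightarrow> real) \<Rightarrow> real)) topology" where
  "compactification_space V t\<^sub>0 \<G> =
     (let X = prod_topology (Alexandroff_compactification (top_of_set V)) (limit_space V t\<^sub>0 \<G>)
      in subtopology X (Abstract_Topology.closure_of X (compactification_map V t\<^sub>0 \<G> ` V)))"

lemma limit_map_in_limit_space:
  assumes "x \<in> V"
  shows "limit_map V t\<^sub>0 \<G> x \<in> topspace (limit_space V t\<^sub>0 \<G>)"
proof -
  have "ball_embed F (Log_vec F t\<^sub>0 (family_map F x)) \<in> family_compactification V t\<^sub>0 F" for F
    using assms by (auto simp: family_compactification_def log_compactification_def amoeba_def)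
  moreover have "ball_embed F (Log_vec F t\<^sub>0 (family_map F x)) \<in> extensional F"
    for F :: "('a \<Rightarrow> real) set"
    by (simp add: ball_embed_def)
  ultimately have 1: "limit_map V t\<^sub>0 \<G> x \<in> (\<Pi>\<^sub>E F\<in>proper_subfamilies V \<G>.
      topspace (subtopology (powertop_real F) (family_compactification V t\<^sub>0 F)))"
    by (simp add: limit_map_def PiE_iff)
  have "limit_map V t\<^sub>0 \<G> x F' = ball_proj F F' (limit_map V t\<^sub>0 \<G> x F)"
    if "F \<in> proper_subfamilies V \<G>" "F' \<in> proper_subfamilies V \<G>" "F' \<subseteq> F" for F F'
  proof -
    have "finite F" using that by (simp add: proper_subfamilies_def finite_proper_family_def)
    moreover have "restrict (Log_vec F t\<^sub>0 (family_map F x)) F' = Log_vec F' t\<^sub>0 (family_map F' x)"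
      using that(3) by (auto simp: Log_vec_def family_map_def fun_eq_iff)
    ultimately show ?thesis
      using that by (simp add: limit_map_def ball_proj_ball_embed)
  qed
  then have 2: "limit_map V t\<^sub>0 \<G> x \<in>
      {m. \<forall>F\<in>proper_subfamilies V \<G>. \<forall>F'\<in>proper_subfamilies V \<G>.
            F' \<subseteq> F \<longrightarrow> m F' = ball_proj F F' (m F)}"
    by (intro CollectI ballI impI)
  from 1 2 show ?thesis
    unfolding limit_space_def topspace_subtopology topspace_product_topology o_def
    by (rule IntI)
qed

section \<open>Actions\<close>

definition semialgebraic_action ::
    "('g, 'b) monoid_scheme \<Rightarrow> 'a::euclidean_space set \<Rightarrow> ('g \<Rightarrow> 'a \<Rightarrow> 'a) \<Rightarrow> bool" where
  "semialgebraic_action G V \<phi> \<longleftrightarrow> group_action G V \<phi> \<and>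
     (\<forall>g\<in>carrier G. continuous_on V (\<phi> g) \<and> semialgebraic_map_on V (\<phi> g))"

definition invariant_family ::
    "('g, 'b) monoid_scheme \<Rightarrow> 'a set \<Rightarrow> ('g \<Rightarrow> 'a \<Rightarrow> 'a) \<Rightarrow> ('a \<Rightarrow> real) set \<Rightarrow> bool" where
  "invariant_family G V \<phi> \<G> \<longleftrightarrow> (\<forall>f\<in>\<G>. \<forall>g\<in>carrier G. compose V f (\<phi> g) \<in> \<G>)"

end

theory Submission
  imports Defs
begin

text \<open>Each map \<open>g\<close> of the action is a homeomorphism of \<open>V\<close>, so it extends to the Alexandroff
  compactification by fixing the point at infinity. On the other factor, pullback along \<open>g\<close> sends
  a finite family \<open>F\<close> to \<open>g\<^sup>*F = {f \<circ> g | f \<in> F}\<close>, and the evaluation map of \<open>F\<close> after \<open>g\<close> is the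
  evaluation map of \<open>g\<^sup>*F\<close> up to the relabelling \<open>f \<mapsto> f \<circ> g\<close> of the coordinates. Invariance
  puts \<open>f \<circ> g\<close> back into the given family, so pullback permutes the finite proper subfamilies, and a point \<open>m\<close> of the inverse limit is
  moved to the point whose component at \<open>F\<close> is the relabelled component of \<open>m\<close> at \<open>g\<^sup>*F\<close>.

  Every ingredient of the inverse limit (norms, logarithms, the ball embedding, logarithmic limit
  sets, the projections between balls) commutes with a relabelling of coordinates. Moreover \<open>g\<close> maps
  \<open>V\<close> onto itself, so \<open>F\<close> and \<open>g\<^sup>*F\<close> have the same image up to relabelling. Hence the rule above is
  a continuous self-map of the inverse limit (\<open>continuous_map_limit_transport\<close>) which carries the
  image of \<open>x\<close> to the image of \<open>g x\<close> (\<open>limit_transport_limit_map\<close>).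

  Together the two extensions form an action of the group on the whole product by continuous maps,
  and this action preserves the image of \<open>V\<close>. By continuity it preserves the closure of that image,
  where it is the required action.\<close>

section \<open>Relabelling coordinates\<close>

definition reindex :: "('i \<Rightarrow> 'j) \<Rightarrow> 'i set \<Rightarrow> ('j \<Rightarrow> 'c) \<Rightarrow> 'i \<Rightarrow> 'c" where
  "reindex h F x = (\<lambda>i\<in>F. x (h i))"

lemma reindex_apply [simp]: "i \<in> F \<Longrightarrow> reindex h F x i = x (h i)"
  by (simp add: reindex_def)

lemma reindex_extensional [simp]: "reindex h F x \<in> extensional F"
  by (simp add: reindex_def)

lemma continuous_map_reindex:
  "continuous_map (product_topology (\<lambda>_. T) (h ` F)) (product_topology (\<lambda>_. T) F) (reindex h F)"
  by (auto simp: continuous_map_componentwise reindex_def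
      intro!: continuous_map_product_projection)

lemma inj_on_reindex: "inj_on (reindex h F) (extensional (h ` F))"
proof (rule inj_onI)
  fix x y
  assume x: "x \<in> extensional (h ` F)" and y: "y \<in> extensional (h ` F)"
    and eq: "reindex h F x = reindex h F y"
  show "x = y"
  proof (rule extensionalityI [OF x y])
    fix j assume "j \<in> h ` F"
    then obtain i where "i \<in> F" "j = h i" by blast
    then show "x j = y j" using fun_cong [OF eq, of i] by simp
  qed
qed

lemma L2_set_reindex:
  assumes "inj_on h F"
  shows "L2_set (reindex h F x) F = L2_set x (h ` F)"
  using assms by (simp add: L2_set_def sum.reindex)

lemma ball_embed_reindex:
  assumes "inj_on h F"
  shows "ball_embed F (reindex h F x) = reindex h F (ball_embed (h ` F) x)"
  using L2_set_reindex [OF assms, of x] by (simp add: ball_embed_def reindex_def fun_eq_iff)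

lemma Log_vec_reindex: "Log_vec F t (reindex h F w) = reindex h F (Log_vec (h ` F) t w)"
  by (simp add: Log_vec_def fun_eq_iff reindex_def)

lemma log_limit_set_reindex:
  assumes "x \<in> log_limit_set (h ` F) W"
  shows "reindex h F x \<in> log_limit_set F (reindex h F ` W)"
proof -
  obtain t w where tw: "\<And>k. 0 < t k \<and> t k < 1 \<and> w k \<in> W" "t \<longlonglongrightarrow> 0"
    and lim: "limitin (powertop_real (h ` F)) (\<lambda>k. Log_vec (h ` F) (t k) (w k)) x sequentially"
    using assms by (auto simp: log_limit_set_def)
  have "limitin (powertop_real F) (\<lambda>k. Log_vec F (t k) (reindex h F (w k))) (reindex h F x)
      sequentially"
    using continuous_map_limit [OF continuous_map_reindex lim] by (simp add: o_def Log_vec_reindex)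
  with tw show ?thesis
    unfolding log_limit_set_def
    by (intro CollectI exI [of _ t] exI [of _ "\<lambda>k. reindex h F (w k)"]) auto
qed

text \<open>On the sphere at infinity: relabelling is continuous, so it respects the limits that define the
  logarithmic limit set, and it preserves the norm, so it respects the choice of unit vectors.\<close>

lemma log_compactification_reindex:
  assumes inj: "inj_on h F" and x: "x \<in> log_compactification (h ` F) t W"
  shows "reindex h F x \<in> log_compactification F t (reindex h F ` W)"
proof (cases "x \<in> log_boundary (h ` F) W")
  case True
  then obtain y where y: "y \<in> log_limit_set (h ` F) W" "L2_set y (h ` F) \<noteq> 0"
    and x_eq: "x = (\<lambda>j\<in>h ` F. y j / L2_set y (h ` F))"
    by (auto simp: log_boundary_def)
  have "reindex h F x = (\<lambda>i\<in>F. reindex h F y i / L2_set (reindex h F y) F)"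
    using L2_set_reindex [OF inj, of y] by (simp add: x_eq reindex_def fun_eq_iff)
  moreover have "reindex h F y \<in> log_limit_set F (reindex h F ` W)"
    using y by (intro log_limit_set_reindex)
  ultimately show ?thesis
    using y unfolding log_compactification_def log_boundary_def
    by (intro UnI2 image_eqI [of _ _ "reindex h F y"]) (auto simp: L2_set_reindex [OF inj])
next
  case False
  then obtain w where "w \<in> W" "x = ball_embed (h ` F) (Log_vec (h ` F) t w)"
    using x by (auto simp: log_compactification_def amoeba_def)
  then show ?thesis
    by (auto simp: log_compactification_def amoeba_def simp flip: ball_embed_reindex [OF inj]
        Log_vec_reindex)
qed

text \<open>The identity holds on all of \<open>\<real>\<^sup>F\<close>, also where \<^const>\<open>ball_proj\<close> divides by zero: the two
  sides take the same branch because relabelling preserves the norm, and division by zero gives zero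
  on both.\<close>

lemma ball_proj_reindex:
  assumes inj: "inj_on h F" and "F' \<subseteq> F"
  shows "ball_proj F F' (reindex h F x) = reindex h F' (ball_proj (h ` F) (h ` F') x)"
proof -
  have inj': "inj_on h F'"
    using assms inj_on_subset by blast
  have restr: "(\<lambda>i\<in>F'. reindex h F x i / c) = reindex h F' (\<lambda>j\<in>h ` F'. x j / c)" for c
    using assms by (auto simp: reindex_def fun_eq_iff)
  have "L2_set (reindex h F x) F' = L2_set (reindex h F' x) F'"
    using assms by (intro L2_set_cong) (auto simp: reindex_def)
  then show ?thesis
    by (simp add: ball_proj_def L2_set_reindex [OF inj] L2_set_reindex [OF inj'] restr
        ball_embed_reindex [OF inj'])
qed

section \<open>Transporting families along a homeomorphism\<close>

text \<open>Distinct functions of a family stay distinct after pullback, so pullback is a relabelling of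
  the coordinates in the sense of the previous part.\<close>

lemma inj_on_compose:
  assumes "u ` V = V"
  shows "inj_on (\<lambda>f. compose V f u) (extensional V)"
proof (rule inj_onI)
  fix f f' :: "'a \<Rightarrow> 'b"
  assume f: "f \<in> extensional V" "f' \<in> extensional V" and eq: "compose V f u = compose V f' u"
  show "f = f'"
  proof (rule extensionalityI [OF f])
    fix y assume "y \<in> V"
    then obtain x where "x \<in> V" "y = u x" using assms by blast
    then show "f y = f' y" using fun_cong [OF eq, of x] by (simp add: compose_eq)
  qed
qed

lemma pos_semialgebraic_functions_extensional:
  "pos_semialgebraic_functions V \<subseteq> extensional V"
  by (auto simp: pos_semialgebraic_functions_def PiE_iff)

text \<open>This is the identity that turns the action on points into a relabelling of coordinates.\<close>

lemma family_map_compose: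
  assumes "x \<in> V"
  shows "reindex (\<lambda>f. compose V f u) F (family_map ((\<lambda>f. compose V f u) ` F) x)
    = family_map F (u x)"
  using assms by (auto simp: family_map_def reindex_def compose_eq fun_eq_iff)

lemma family_compactification_compose:
  assumes u: "u ` V = V" and F: "F \<subseteq> extensional V"
    and x: "x \<in> family_compactification V t ((\<lambda>f. compose V f u) ` F)"
  shows "reindex (\<lambda>f. compose V f u) F x \<in> family_compactification V t F"
proof -
  let ?h = "\<lambda>f. compose V f u"
  have "inj_on ?h F"
    using inj_on_compose [OF u] F by (rule inj_on_subset)
  then have "reindex ?h F x \<in> log_compactification F t (reindex ?h F ` family_map (?h ` F) ` V)"
    using x unfolding family_compactification_def by (rule log_compactification_reindex)
  moreover have "reindex ?h F ` family_map (?h ` F) ` V = family_map F ` u ` V"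
    unfolding image_image by (intro image_cong refl family_map_compose)
  ultimately show ?thesis
    by (simp add: family_compactification_def u)
qed

lemma proper_map_cong:
  assumes f: "proper_map X Y f" and eq: "\<And>x. x \<in> topspace X \<Longrightarrow> f x = g x"
  shows "proper_map X Y g"
  unfolding proper_map_def closed_map_def
proof (intro conjI allI impI ballI)
  fix C assume C: "closedin X C"
  then have "f ` C = g ` C"
    using eq closedin_subset by (intro image_cong) blast+
  then show "closedin Y (g ` C)"
    using f C by (metis proper_map_def closed_map_def)
next
  fix y assume "y \<in> topspace Y"
  moreover have "{x \<in> topspace X. g x = y} = {x \<in> topspace X. f x = y}"
    using eq by auto
  ultimately show "compactin X {x \<in> topspace X. g x = y}"
    using f by (simp add: proper_map_def)
qed

text \<open>The evaluation map of the pulled back family, followed by the relabelling, is a proper map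
  precomposed with a homeomorphism. The relabelling is continuous and injective, so it can be
  cancelled without losing properness.\<close>

lemma finite_proper_family_compose:
  assumes u: "homeomorphic_map (top_of_set V) (top_of_set V) u"
    and F: "finite_proper_family V F"
    and pos: "(\<lambda>f. compose V f u) ` F \<subseteq> pos_semialgebraic_functions V"
  shows "finite_proper_family V ((\<lambda>f. compose V f u) ` F)"
proof -
  let ?h = "\<lambda>f. compose V f u"
  let ?T = "\<lambda>F. product_topology (\<lambda>_. top_of_set {0<..}) F :: (('a \<Rightarrow> real) \<Rightarrow> real) topology"
  have "proper_map (top_of_set V) (?T F) (family_map F \<circ> u)"
    using homeomorphic_imp_proper_map [OF u] F
    by (auto simp: finite_proper_family_def intro: proper_map_compose)
  then have "proper_map (top_of_set V) (?T F) (reindex ?h F \<circ> family_map (?h ` F))"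
    by (rule proper_map_cong) (simp add: family_map_compose)
  moreover have "family_map (?h ` F) \<in> topspace (top_of_set V) \<rightarrow> topspace (?T (?h ` F))"
    using pos by (auto simp: family_map_def pos_semialgebraic_functions_def PiE_iff)
  moreover have "inj_on (reindex ?h F) (topspace (?T (?h ` F)))"
    using inj_on_reindex by (rule inj_on_subset) (auto simp: PiE_iff)
  ultimately have "proper_map (top_of_set V) (?T (?h ` F)) (family_map (?h ` F))"
    by (rule proper_map_from_composition_right_inj [OF _ _ continuous_map_reindex])
  with F pos show ?thesis
    by (simp add: finite_proper_family_def)
qed

lemma proper_subfamilies_compose:
  assumes u: "homeomorphic_map (top_of_set V) (top_of_set V) u"
    and \<G>: "\<G> \<subseteq> pos_semialgebraic_functions V"
    and inv: "\<And>f. f \<in> \<G> \<Longrightarrow> compose V f u \<in> \<G>"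
    and F: "F \<in> proper_subfamilies V \<G>"
  shows "(\<lambda>f. compose V f u) ` F \<in> proper_subfamilies V \<G>"
proof -
  have "(\<lambda>f. compose V f u) ` F \<subseteq> \<G>"
    using F inv by (auto simp: proper_subfamilies_def)
  then show ?thesis
    using F \<G> finite_proper_family_compose [OF u] by (auto simp: proper_subfamilies_def)
qed

section \<open>The induced maps on the inverse limit\<close>

text \<open>The rule \<open>m \<mapsto> (F \<mapsto> m (u\<^sup>*F))\<close>, with the coordinates of \<open>m (u\<^sup>*F)\<close> relabelled by \<open>F\<close>. Pullback
  of functions reverses the order of composition, and evaluating \<open>m\<close> at the pulled back family
  reverses it a second time, so the rule is covariant in \<open>u\<close> and yields a left action.\<close>

definition limit_transport ::
    "'a set \<Rightarrow> ('a \<Rightarrow> real) set set \<Rightarrow> ('a \<Rightarrow> 'a)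
       \<Rightarrow> (('a \<Rightarrow> real) set \<Rightarrow> ('a \<Rightarrow> real) \<Rightarrow> real) \<Rightarrow> ('a \<Rightarrow> real) set \<Rightarrow> ('a \<Rightarrow> real) \<Rightarrow> real" where
  "limit_transport V P u m =
     (\<lambda>F\<in>P. reindex (\<lambda>f. compose V f u) F (m ((\<lambda>f. compose V f u) ` F)))"

lemma limit_transport_compose:
  assumes P: "\<And>F. F \<in> P \<Longrightarrow> (\<lambda>f. compose V f u) ` F \<in> P" and w: "w \<in> V \<rightarrow> V"
  shows "limit_transport V P u (limit_transport V P w m) = limit_transport V P (compose V u w) m"
proof -
  have "compose V (compose V f u) w = compose V f (compose V u w)" for f :: "'a \<Rightarrow> real"
    using w by (simp add: compose_assoc)
  then show ?thesis
    using P by (simp add: limit_transport_def reindex_def image_image cong: restrict_cong)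
qed

lemma limit_space_extensional:
  assumes "m \<in> topspace (limit_space V t \<G>)"
  shows "m \<in> extensional (proper_subfamilies V \<G>)"
    and "F \<in> proper_subfamilies V \<G> \<Longrightarrow> m F \<in> extensional F"
proof -
  have "m \<in> (\<Pi>\<^sub>E F\<in>proper_subfamilies V \<G>.
      topspace (subtopology (powertop_real F) (family_compactification V t F)))"
    using assms unfolding limit_space_def topspace_subtopology topspace_product_topology o_def
    by (rule IntD1)
  then show "m \<in> extensional (proper_subfamilies V \<G>)"
    and "F \<in> proper_subfamilies V \<G> \<Longrightarrow> m F \<in> extensional F"
    by (auto simp: PiE_iff)
qed

lemma limit_space_coherent:
  assumes "m \<in> topspace (limit_space V t \<G>)"
    and "F \<in> proper_subfamilies V \<G>" "F' \<in> proper_subfamilies V \<G>" "F' \<subseteq> F"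
  shows "m F' = ball_proj F F' (m F)"
  using assms unfolding limit_space_def topspace_subtopology by blast

lemma continuous_map_into_limit_space:
  assumes "continuous_map X (product_topology
      (\<lambda>F. subtopology (powertop_real F) (family_compactification V t F))
      (proper_subfamilies V \<G>)) f"
    and "\<And>x F F'. x \<in> topspace X \<Longrightarrow> F \<in> proper_subfamilies V \<G> \<Longrightarrow>
      F' \<in> proper_subfamilies V \<G> \<Longrightarrow> F' \<subseteq> F \<Longrightarrow> f x F' = ball_proj F F' (f x F)"
  shows "continuous_map X (limit_space V t \<G>) f"
  unfolding limit_space_def
  using assms(1)
proof (rule continuous_map_into_subtopology)
  show "f \<in> topspace X \<rightarrow> {m. \<forall>F\<in>proper_subfamilies V \<G>. \<forall>F'\<in>proper_subfamilies V \<G>.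
      F' \<subseteq> F \<longrightarrow> m F' = ball_proj F F' (m F)}"
    using assms(2) by blast
qed

lemma limit_transport_id:
  assumes m: "m \<in> topspace (limit_space V t \<G>)"
  shows "limit_transport V (proper_subfamilies V \<G>) (\<lambda>x\<in>V. x) m = m"
proof (rule extensionalityI [OF _ limit_space_extensional(1) [OF m]])
  let ?h = "\<lambda>f. compose V f (\<lambda>x\<in>V. x)"
  show "limit_transport V (proper_subfamilies V \<G>) (\<lambda>x\<in>V. x) m
      \<in> extensional (proper_subfamilies V \<G>)"
    by (simp add: limit_transport_def)
  fix F assume F: "F \<in> proper_subfamilies V \<G>"
  then have id: "?h f = f" if "f \<in> F" for f
    using that pos_semialgebraic_functions_extensional [of V]
    by (auto simp: proper_subfamilies_def finite_proper_family_def fun_eq_iff compose_def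
        extensional_def)
  then have "?h ` F = F"
    by (simp cong: image_cong_simp)
  moreover have "reindex ?h F (m F) = m F"
    by (rule extensionalityI [OF _ limit_space_extensional(2) [OF m F]]) (simp_all add: id)
  ultimately show "limit_transport V (proper_subfamilies V \<G>) (\<lambda>x\<in>V. x) m F = m F"
    using F by (simp add: limit_transport_def)
qed

lemma limit_transport_limit_map:
  assumes u: "u ` V = V" and \<G>: "\<G> \<subseteq> extensional V"
    and P: "\<And>F. F \<in> proper_subfamilies V \<G> \<Longrightarrow>
      (\<lambda>f. compose V f u) ` F \<in> proper_subfamilies V \<G>"
    and x: "x \<in> V"
  shows "limit_transport V (proper_subfamilies V \<G>) u (limit_map V t \<G> x)
    = limit_map V t \<G> (u x)"
proof -
  let ?h = "\<lambda>f. compose V f u"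
  have "reindex ?h F (ball_embed (?h ` F) (Log_vec (?h ` F) t (family_map (?h ` F) x)))
      = ball_embed F (Log_vec F t (family_map F (u x)))"
    if "F \<in> proper_subfamilies V \<G>" for F
  proof -
    have "F \<subseteq> extensional V"
      using that \<G> by (auto simp: proper_subfamilies_def)
    then have "inj_on ?h F"
      using inj_on_compose [OF u] inj_on_subset by blast
    then show ?thesis
      by (simp add: ball_embed_reindex Log_vec_reindex x flip: family_map_compose [of x V u F])
  qed
  then show ?thesis
    using P by (auto simp: limit_transport_def limit_map_def fun_eq_iff)
qed

text \<open>Each component of the image depends on one component of \<open>m\<close> only, through a continuous
  relabelling. Coherence of the image at \<open>F' \<subseteq> F\<close> is coherence of \<open>m\<close> at \<open>u\<^sup>*F' \<subseteq> u\<^sup>*F\<close>.\<close>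

lemma continuous_map_limit_transport:
  assumes u: "u ` V = V" and \<G>: "\<G> \<subseteq> extensional V"
    and P: "\<And>F. F \<in> proper_subfamilies V \<G> \<Longrightarrow>
      (\<lambda>f. compose V f u) ` F \<in> proper_subfamilies V \<G>"
  shows "continuous_map (limit_space V t \<G>) (limit_space V t \<G>)
    (limit_transport V (proper_subfamilies V \<G>) u)"
proof -
  let ?h = "\<lambda>f. compose V f u" and ?P = "proper_subfamilies V \<G>"
  let ?T = "\<lambda>F. subtopology (powertop_real F) (family_compactification V t F)"
  have ext: "F \<subseteq> extensional V" if "F \<in> ?P" for F
    using that \<G> by (auto simp: proper_subfamilies_def)
  have inj: "inj_on ?h F" if "F \<in> ?P" for F
    using inj_on_compose [OF u] ext [OF that] by (rule inj_on_subset)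
  have "continuous_map (limit_space V t \<G>) (?T F) (\<lambda>m. reindex ?h F (m (?h ` F)))"
    if F: "F \<in> ?P" for F
  proof -
    have "continuous_map (limit_space V t \<G>) (?T (?h ` F)) (\<lambda>m. m (?h ` F))"
      unfolding limit_space_def
      by (intro continuous_map_from_subtopology continuous_map_product_projection P F)
    moreover have "continuous_map (?T (?h ` F)) (?T F) (reindex ?h F)"
      using family_compactification_compose [OF u ext [OF F]]
      by (auto simp: continuous_map_in_subtopology
          intro!: continuous_map_from_subtopology continuous_map_reindex)
    ultimately have "continuous_map (limit_space V t \<G>) (?T F) (reindex ?h F \<circ> (\<lambda>m. m (?h ` F)))"
      by (rule continuous_map_compose)
    then show ?thesis by (simp add: o_def)
  qed
  then have "continuous_map (limit_space V t \<G>) (product_topology ?T ?P) (limit_transport V ?P u)"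
    by (auto simp: continuous_map_componentwise limit_transport_def)
  moreover have "limit_transport V ?P u m F' = ball_proj F F' (limit_transport V ?P u m F)"
    if m: "m \<in> topspace (limit_space V t \<G>)" and F: "F \<in> ?P" "F' \<in> ?P" "F' \<subseteq> F" for m F F'
  proof -
    have "m (?h ` F') = ball_proj (?h ` F) (?h ` F') (m (?h ` F))"
      by (intro limit_space_coherent [OF m] P F image_mono)
    then show ?thesis
      using F by (simp add: limit_transport_def ball_proj_reindex inj)
  qed
  ultimately show ?thesis
    by (rule continuous_map_into_limit_space)
qed

section \<open>Extending the action\<close>

text \<open>Properness makes the preimage of a compact set compact, which is what continuity at the point
  at infinity requires.\<close>

lemma continuous_map_Alexandroff_compactification:
  assumes f: "continuous_map X Y f" and proper: "proper_map X Y f"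
  shows "continuous_map (Alexandroff_compactification X) (Alexandroff_compactification Y)
    (map_option f)"
  unfolding continuous_map
proof (intro conjI allI impI)
  have im: "x \<in> topspace X \<Longrightarrow> f x \<in> topspace Y" for x
    using f by (auto simp: continuous_map)
  then show "map_option f ` topspace (Alexandroff_compactification X)
      \<subseteq> topspace (Alexandroff_compactification Y)"
    by auto
  fix U assume "openin (Alexandroff_compactification Y) U"
  then consider (base) W where "openin Y W" "U = Some ` W"
    | (ext) C where "compactin Y C" "closedin Y C" "U = insert None (Some ` (topspace Y - C))"
    by (auto simp: openin_Alexandroff_compactification)
  then show "openin (Alexandroff_compactification X)
      {x \<in> topspace (Alexandroff_compactification X). map_option f x \<in> U}"
  proof cases
    case base
    have "{x \<in> topspace (Alexandroff_compactification X). map_option f x \<in> U}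
        = Some ` {x \<in> topspace X. f x \<in> W}"
      using base by auto
    then show ?thesis
      using openin_continuous_map_preimage [OF f base(1)] by simp
  next
    case ext
    let ?C = "{x \<in> topspace X. f x \<in> C}"
    have "{x \<in> topspace (Alexandroff_compactification X). map_option f x \<in> U}
        = insert None (Some ` (topspace X - ?C))"
      using ext im by auto
    moreover have "compactin X ?C" "closedin X ?C"
      using compactin_proper_map_preimage [OF proper ext(1)]
        closedin_continuous_map_preimage [OF f ext(2)] by auto
    ultimately show ?thesis
      by (auto simp: openin_Alexandroff_compactification)
  qed
qed

text \<open>The restriction to \<open>E\<close> is forced by \<^const>\<open>BijGroup\<close>, whose elements are extensional
  functions; bijectivity of each map comes from the inverse group element.\<close>

lemma group_actionI:
  assumes G: "group G"
    and closed: "\<And>g x. g \<in> carrier G \<Longrightarrow> x \<in> E \<Longrightarrow> \<Psi> g x \<in> E"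
    and one: "\<And>x. x \<in> E \<Longrightarrow> \<Psi> \<one>\<^bsub>G\<^esub> x = x"
    and mult: "\<And>g h x. g \<in> carrier G \<Longrightarrow> h \<in> carrier G \<Longrightarrow> x \<in> E \<Longrightarrow>
      \<Psi> (g \<otimes>\<^bsub>G\<^esub> h) x = \<Psi> g (\<Psi> h x)"
  shows "group_action G E (\<lambda>g. restrict (\<Psi> g) E)"
proof -
  interpret group G by (rule G)
  have inv: "\<Psi> (inv\<^bsub>G\<^esub> g) (\<Psi> g x) = x" "\<Psi> g (\<Psi> (inv\<^bsub>G\<^esub> g) x) = x"
    if "g \<in> carrier G" "x \<in> E" for g x
    using that mult [of "inv\<^bsub>G\<^esub> g" g x] mult [of g "inv\<^bsub>G\<^esub> g" x] one by simp_all
  have "bij_betw (\<Psi> g) E E" if "g \<in> carrier G" for g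
    using that closed inv by (intro bij_betw_byWitness [where f' = "\<Psi> (inv\<^bsub>G\<^esub> g)"]) auto
  then have Bij: "restrict (\<Psi> g) E \<in> Bij E" if "g \<in> carrier G" for g
    using that by (simp add: Bij_def bij_betw_restrict_eq)
  have "restrict (\<Psi> (g \<otimes>\<^bsub>G\<^esub> h)) E = compose E (restrict (\<Psi> g) E) (restrict (\<Psi> h) E)"
    if "g \<in> carrier G" "h \<in> carrier G" for g h
    using that closed mult by (auto simp: fun_eq_iff compose_def)
  then have "(\<lambda>g. restrict (\<Psi> g) E) \<in> hom G (BijGroup E)"
    using Bij by (auto simp: hom_def BijGroup_def)
  then show ?thesis
    unfolding group_action_def group_hom_def group_hom_axioms_def
    using G group_BijGroup by blast
qed

theorem mainTheorem7:
  fixes V :: "(real ^ 'n) set"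
    and G :: "('g, 'b) monoid_scheme"
    and \<phi> :: "'g \<Rightarrow> real ^ 'n \<Rightarrow> real ^ 'n"
    and \<G> :: "(real ^ 'n \<Rightarrow> real) set"
    and t\<^sub>0 :: real
  assumes "0 < t\<^sub>0" and "t\<^sub>0 < 1"
    and "semialgebraic V"
    and "semialgebraic_action G V \<phi>"
    and "proper_family V \<G>"
    and "invariant_family G V \<phi> \<G>"
  shows "\<exists>\<psi>. group_action G (topspace (compactification_space V t\<^sub>0 \<G>)) \<psi> \<and>
    (\<forall>g\<in>carrier G.
      continuous_map (compactification_space V t\<^sub>0 \<G>) (compactification_space V t\<^sub>0 \<G>) (\<psi> g) \<and>
      (\<forall>x\<in>V. \<psi> g (compactification_map V t\<^sub>0 \<G> x) = compactification_map V t\<^sub>0 \<G> (\<phi> g x)))"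
proof -
  let ?X = "prod_topology (Alexandroff_compactification (top_of_set V)) (limit_space V t\<^sub>0 \<G>)"
  let ?P = "proper_subfamilies V \<G>" and ?E = "topspace (compactification_space V t\<^sub>0 \<G>)"
  define \<Psi> where "\<Psi> g = map_prod (map_option (\<phi> g)) (limit_transport V ?P (\<phi> g))" for g
  interpret group_action G V \<phi>
    using \<open>semialgebraic_action G V \<phi>\<close> by (simp add: semialgebraic_action_def)
  have G: "group G"
    using group_hom by (simp add: group_hom_def)
  then interpret group G .
  have \<G>: "\<G> \<subseteq> pos_semialgebraic_functions V"
    using \<open>proper_family V \<G>\<close> by (simp add: proper_family_def)
  then have ext: "\<G> \<subseteq> extensional V"
    using pos_semialgebraic_functions_extensional by blast
  have one: "\<phi> \<one>\<^bsub>G\<^esub> = (\<lambda>x\<in>V. x)"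
    by (rule id_eq_one [symmetric])
  have mult: "\<phi> (g \<otimes>\<^bsub>G\<^esub> h) = compose V (\<phi> g) (\<phi> h)" if "g \<in> carrier G" "h \<in> carrier G" for g h
    using that bij_prop0 [of "g \<otimes>\<^bsub>G\<^esub> h"] composition_rule
    by (intro extensionalityI [of _ V]) (auto simp: Bij_def compose_eq)
  have cont: "continuous_map (top_of_set V) (top_of_set V) (\<phi> g)" if "g \<in> carrier G" for g
    using that surj_prop \<open>semialgebraic_action G V \<phi>\<close> by (auto simp: semialgebraic_action_def)
  have homeo: "homeomorphic_map (top_of_set V) (top_of_set V) (\<phi> g)" if g: "g \<in> carrier G" for g
  proof -
    have inv: "inv\<^bsub>G\<^esub> g \<in> carrier G" using g by simp
    have "\<phi> (inv\<^bsub>G\<^esub> g) (\<phi> g x) = x" if "x \<in> V" for x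
      using orbit_sym_aux [OF g that refl] .
    moreover have "\<phi> g (\<phi> (inv\<^bsub>G\<^esub> g) x) = x" if "x \<in> V" for x
      using orbit_sym_aux [OF inv that refl] g by simp
    ultimately have "homeomorphic_maps (top_of_set V) (top_of_set V) (\<phi> g) (\<phi> (inv\<^bsub>G\<^esub> g))"
      using cont [OF g] cont [OF inv] by (simp add: homeomorphic_maps_def)
    then show ?thesis by (auto simp: homeomorphic_map_maps)
  qed
  have P: "(\<lambda>f. compose V f (\<phi> g)) ` F \<in> ?P" if "g \<in> carrier G" "F \<in> ?P" for g F
    using that \<open>invariant_family G V \<phi> \<G>\<close>
    by (intro proper_subfamilies_compose homeo \<G>) (auto simp: invariant_family_def)
  have \<Psi>_cont: "continuous_map ?X ?X (\<Psi> g)" if g: "g \<in> carrier G" for g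
  proof -
    have "continuous_map (limit_space V t\<^sub>0 \<G>) (limit_space V t\<^sub>0 \<G>) (limit_transport V ?P (\<phi> g))"
      using g by (intro continuous_map_limit_transport surj_prop ext P)
    moreover have "continuous_map (Alexandroff_compactification (top_of_set V))
        (Alexandroff_compactification (top_of_set V)) (map_option (\<phi> g))"
      using g by (intro continuous_map_Alexandroff_compactification homeomorphic_imp_proper_map
          cont homeo)
    ultimately show ?thesis
      by (simp add: \<Psi>_def map_prod_def continuous_map_prod_top)
  qed
  have \<Psi>_map: "\<Psi> g (compactification_map V t\<^sub>0 \<G> x) = compactification_map V t\<^sub>0 \<G> (\<phi> g x)"
    if "g \<in> carrier G" "x \<in> V" for g x
    using that by (simp add: \<Psi>_def compactification_map_def limit_transport_limit_map
        surj_prop ext P)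
  have E: "?E = Abstract_Topology.closure_of ?X (compactification_map V t\<^sub>0 \<G> ` V)"
    unfolding compactification_space_def Let_def topspace_subtopology
    by (rule Int_absorb1 [OF closure_of_subset_topspace])
  have space: "compactification_space V t\<^sub>0 \<G> = subtopology ?X ?E"
    unfolding E by (simp add: compactification_space_def Let_def)
  have E_X: "?E \<subseteq> topspace ?X"
    unfolding E by (rule closure_of_subset_topspace)
  have \<Psi>_E: "\<Psi> g p \<in> ?E" if g: "g \<in> carrier G" and "p \<in> ?E" for g p
  proof -
    have "\<Psi> g ` compactification_map V t\<^sub>0 \<G> ` V \<subseteq> compactification_map V t\<^sub>0 \<G> ` V"
      using \<Psi>_map [OF g] element_image [OF g] by force
    then have "Abstract_Topology.closure_of ?X (\<Psi> g ` compactification_map V t\<^sub>0 \<G> ` V) \<subseteq> ?E"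
      unfolding E by (rule closure_of_mono)
    with continuous_map_image_closure_subset [OF \<Psi>_cont [OF g]] \<open>p \<in> ?E\<close> show ?thesis
      unfolding E by blast
  qed
  have "group_action G ?E (\<lambda>g. restrict (\<Psi> g) ?E)"
  proof (rule group_actionI [OF G \<Psi>_E])
    show "\<Psi> \<one>\<^bsub>G\<^esub> p = p" if "p \<in> ?E" for p
      using that E_X by (auto simp: \<Psi>_def one limit_transport_id)
    show "\<Psi> (g \<otimes>\<^bsub>G\<^esub> h) p = \<Psi> g (\<Psi> h p)"
      if g: "g \<in> carrier G" and h: "h \<in> carrier G" and "p \<in> ?E" for g h p
    proof -
      obtain a m where p: "p = (a, m)" and a: "a \<in> insert None (Some ` V)"
        using \<open>p \<in> ?E\<close> E_X by (cases p) auto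
      have "\<phi> h \<in> V \<rightarrow> V"
        using h element_image by blast
      then have "limit_transport V ?P (\<phi> (g \<otimes>\<^bsub>G\<^esub> h)) m
          = limit_transport V ?P (\<phi> g) (limit_transport V ?P (\<phi> h) m)"
        using P [OF g] by (simp add: mult [OF g h] limit_transport_compose)
      then show ?thesis
        using a g h by (auto simp: p \<Psi>_def composition_rule)
    qed
  qed auto
  moreover have "continuous_map (compactification_space V t\<^sub>0 \<G>) (compactification_space V t\<^sub>0 \<G>)
      (restrict (\<Psi> g) ?E)" if g: "g \<in> carrier G" for g
  proof -
    have "continuous_map (subtopology ?X ?E) (subtopology ?X ?E) (\<Psi> g)"
      using \<Psi>_E [OF g] continuous_map_from_subtopology [OF \<Psi>_cont [OF g]]
      by (auto simp: continuous_map_in_subtopology)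
    then show ?thesis
      unfolding space [symmetric] by (rule continuous_map_eq) simp
  qed
  moreover have "compactification_map V t\<^sub>0 \<G> x \<in> ?E" if "x \<in> V" for x
  proof -
    have "compactification_map V t\<^sub>0 \<G> ` V \<subseteq> topspace ?X"
      using limit_map_in_limit_space by (auto simp: compactification_map_def)
    then have "compactification_map V t\<^sub>0 \<G> ` V \<subseteq> ?E"
      unfolding E by (rule closure_of_subset)
    with that show ?thesis by blast
  qed
  ultimately show ?thesis
    using \<Psi>_map by (intro exI [of _ "\<lambda>g. restrict (\<Psi> g) ?E"]) auto
qed

end
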